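(* Let $R>0$, let $N\ge 1$ be an integer, put $w=R/N$, and let $\varepsilon_1\le \varepsilon_2\le\dots\le\varepsilon_N$ be equally spaced points of $[0,R]$. Let $\rho:[0,R]\to[0,\infty)$ be a given function. For $i,j,k,l\in\{1,\dots,N\}$ define $\delta_{ij}^{kl}=1/w$ if $i+j=k+l$ and $\delta_{ij}^{kl}=0$ otherwise. For $f=(f_1,\dots,f_N)$ set $$\tilde Q_R(f)(\varepsilon_i)=\sum_{j,k,l=1}^N w^3\,\delta_{ij}^{kl}\,\rho(\min\{\varepsilon_i,\varepsilon_j,\varepsilon_k,\varepsilon_l\})\,\bigl[f_kf_l(1+f_i)(1+f_j)-f_if_j(1+f_k)(1+f_l)\bigr].$$ Let $f_i=f_i(t)\ge 0$, $i=1,\dots,N$, be a solution of the initial value problem $$\rho(\varepsilon_i)\frac{df_i}{dt}=\tilde Q_R(f)(\varepsilon_i),\quad t>0,\qquad f_i(0)=f_{0,R}(\varepsilon_i)\ge 0,\qquad i=1,\dots,N .$$ Then, for $t>0$, the following hold. (a) (Discrete conservation) For $\phi(\varepsilon)=1$ and for $\phi(\varepsilon)=\varepsilon$, $$w\sum_{i=1}^N\rho(\varepsilon_i)\frac{df_i}{dt}\,\phi(\varepsilon_i)=0 .$$ (b) (Discrete entropy principle) With $h(y)=(1+y)\log(1+y)-y\log y$, $$w\sum_{i=1}^N\rho(\varepsilon_i)\frac{d\,h(f_i)}{dt}\ \ge 0 .$$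
   Context: Here $\rho$ is the (given, nonnegative) density of states, $f_i(t)$ approximates the nonnegative boson density at energy $\varepsilon_i$, and $f_{0,R}:[0,R]\to[0,\infty)$ is a given initial datum. A solution consists of functions $f_i$ continuous at $t=0$ and differentiable for $t>0$ (on the time interval where the solution exists). Convention: $0\log 0=0$, so that $h(0)=0$. In (b), the inequality is understood at times $t>0$ where the derivatives $d\,h(f_i)/dt$ with $\rho(\varepsilon_i)>0$ exist, and a term with $\rho(\varepsilon_i)=0$ counts as zero. *)

theory Defs
  imports "HOL-Analysis.Analysis"
begin

definition equally_spaced :: "nat \<Rightarrow> (nat \<Rightarrow> real) \<Rightarrow> bool" where
  "equally_spaced N \<epsilon> \<longleftrightarrow> (\<exists>d. \<forall>i\<in>{1..<N}. \<epsilon> (Suc i) - \<epsilon> i = d)"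

definition discrete_delta :: "real \<Rightarrow> nat \<Rightarrow> nat \<Rightarrow> nat \<Rightarrow> nat \<Rightarrow> real" where
  "discrete_delta w i j k l = (if i + j = k + l then 1 / w else 0)"

definition discrete_collision ::
  "real \<Rightarrow> nat \<Rightarrow> (real \<Rightarrow> real) \<Rightarrow> (nat \<Rightarrow> real) \<Rightarrow> (nat \<Rightarrow> real) \<Rightarrow> nat \<Rightarrow> real" where
  "discrete_collision R N \<rho> \<epsilon> f i =
     (let w = R / real N in
      \<Sum>j=1..N. \<Sum>k=1..N. \<Sum>l=1..N.
        w ^ 3 * discrete_delta w i j k l * \<rho> (Min {\<epsilon> i, \<epsilon> j, \<epsilon> k, \<epsilon> l}) *
        (f k * f l * (1 + f i) * (1 + f j) - f i * f j * (1 + f k) * (1 + f l)))"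

text \<open>A nonnegative solution on the time interval \<open>[0, T)\<close>, where \<open>T = \<infinity>\<close> is allowed. The
  component functions are total, but their values outside \<open>[0, T)\<close> are irrelevant. All components
  are differentiable, also those with \<open>\<rho> (\<epsilon> i) = 0\<close>, for which the equation is only an
  algebraic constraint.\<close>

definition discrete_solution ::
  "real \<Rightarrow> nat \<Rightarrow> (real \<Rightarrow> real) \<Rightarrow> (nat \<Rightarrow> real) \<Rightarrow> (real \<Rightarrow> real) \<Rightarrow> ereal
    \<Rightarrow> (nat \<Rightarrow> real \<Rightarrow> real) \<Rightarrow> bool" where
  "discrete_solution R N \<rho> \<epsilon> f\<^sub>0 T f \<longleftrightarrow>
     (\<forall>i\<in>{1..N}.
        f i 0 = f\<^sub>0 (\<epsilon> i) \<and>
        continuous (at_right 0) (f i) \<and>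
        (\<forall>t. 0 \<le> t \<and> ereal t < T \<longrightarrow> 0 \<le> f i t) \<and>
        (\<forall>t. 0 < t \<and> ereal t < T \<longrightarrow>
           f i differentiable (at t) \<and>
           \<rho> (\<epsilon> i) * deriv (f i) t = discrete_collision R N \<rho> \<epsilon> (\<lambda>j. f j t) i))"

text \<open>The convention \<open>0 log 0 = 0\<close> is automatic: \<open>ln 0\<close> has some real value, and it is multiplied by \<open>0\<close>.\<close>

definition entropy_density :: "real \<Rightarrow> real" where
  "entropy_density y = (1 + y) * ln (1 + y) - y * ln y"

end

theory Submission
  imports Defs
begin

text \<open>
  The kernel of the collision operator, as a function of the four indices \<open>i, j, k, l\<close>, is symmetric
  in \<open>i, j\<close>, symmetric in \<open>k, l\<close>, and changes sign when the pairs \<open>(i, j)\<close> and \<open>(k, l)\<close> are exchanged.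
  Tested against any \<open>g\<close>, it can therefore be averaged over these exchanges (the discrete analogue
  of the weak form of the Boltzmann equation): \<open>4 \<Sum>\<^sub>i Q\<^sub>i g\<^sub>i\<close> is the sum of the kernel
  times \<open>g\<^sub>i + g\<^sub>j - g\<^sub>k - g\<^sub>l\<close>, which is \<open>sum_collision_weak_form\<close>.

  Conservation follows because the kernel lives on \<open>i + j = k + l\<close>, and \<open>1\<close> and \<open>\<epsilon>\<^sub>i\<close> are affine in
  \<open>i\<close>. For the entropy take \<open>g\<^sub>i = h'(f\<^sub>i) = ln (1 + f\<^sub>i) - ln f\<^sub>i\<close>. With \<open>X = f\<^sub>k f\<^sub>l (1 + f\<^sub>i) (1 + f\<^sub>j)\<close> and
  \<open>Y = f\<^sub>i f\<^sub>j (1 + f\<^sub>k) (1 + f\<^sub>l)\<close>, each term of the symmetrised sum is a nonnegative multiple of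
  \<open>(X - Y) (ln X - ln Y) \<ge> 0\<close>, as long as the four values of \<open>f\<close> are positive.

  The delicate point is the vacuum \<open>f\<^sub>i(t) = 0\<close>, where \<open>h'\<close> is infinite. A nonnegative \<open>f\<^sub>i\<close> attains
  there a minimum in time, so \<open>f\<^sub>i' = 0\<close>, and the equation yields \<open>Q\<^sub>i = 0\<close>. In \<open>Q\<^sub>i\<close> only the
  gain terms survive when \<open>f\<^sub>i = 0\<close>; they are nonnegative and sum to zero, so each one is zero.
  Hence every kernel entry that involves an empty energy level vanishes, and such
  quadruples drop out of the symmetrised sum (\<open>collision_kernel_empty_level\<close>,
  \<open>sum_collision_entropy_nonneg\<close>). Likewise \<open>h(f\<^sub>i) \<ge> 0 = h(0)\<close> has a minimum at
  \<open>t\<close>, so its derivative, if it exists, is zero.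
\<close>

section \<open>Weak form of the collision operator\<close>

text \<open>
  Each exchange of indices is a bijection of the set of quadruples onto itself, so every one of the
  four terms on the right contributes the same amount.
\<close>

lemma sum_antisymmetric_kernel:
  fixes K :: "'a \<Rightarrow> 'a \<Rightarrow> 'a \<Rightarrow> 'a \<Rightarrow> real" and g :: "'a \<Rightarrow> real"
  assumes swap_left: "\<And>i j k l. K j i k l = K i j k l"
    and swap_right: "\<And>i j k l. K i j l k = K i j k l"
    and exchange: "\<And>i j k l. K k l i j = - K i j k l"
  shows "4 * (\<Sum>i\<in>I. (\<Sum>j\<in>I. \<Sum>k\<in>I. \<Sum>l\<in>I. K i j k l) * g i) =
    (\<Sum>i\<in>I. \<Sum>j\<in>I. \<Sum>k\<in>I. \<Sum>l\<in>I. K i j k l * (g i + g j - g k - g l))"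
proof -
  let ?P = "I \<times> I \<times> I \<times> I"
  define S where "S F = (\<Sum>(i, j, k, l)\<in>?P. F i j k l)" for F :: "'a \<Rightarrow> 'a \<Rightarrow> 'a \<Rightarrow> 'a \<Rightarrow> real"
  have nested: "(\<Sum>i\<in>I. \<Sum>j\<in>I. \<Sum>k\<in>I. \<Sum>l\<in>I. F i j k l) = S F" for F
    unfolding S_def by (simp add: sum.cartesian_product)
  have j: "S (\<lambda>i j k l. K i j k l * g j) = S (\<lambda>i j k l. K i j k l * g i)"
    unfolding S_def
    by (rule sum.reindex_bij_witness[where i = "\<lambda>(i, j, k, l). (j, i, k, l)"
          and j = "\<lambda>(i, j, k, l). (j, i, k, l)"]) (auto simp: swap_left)
  have neg: "- (K i j k l * x) = K k l i j * x" for i j k l x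
    unfolding exchange[of i j k l] by simp
  have k: "S (\<lambda>i j k l. K i j k l * g k) = S (\<lambda>i j k l. - (K i j k l * g i))"
    unfolding S_def
    by (rule sum.reindex_bij_witness[where i = "\<lambda>(i, j, k, l). (k, l, i, j)"
          and j = "\<lambda>(i, j, k, l). (k, l, i, j)"]) (auto simp: neg)
  have l: "S (\<lambda>i j k l. K i j k l * g l) = S (\<lambda>i j k l. K i j k l * g k)"
    unfolding S_def
    by (rule sum.reindex_bij_witness[where i = "\<lambda>(i, j, k, l). (i, j, l, k)"
          and j = "\<lambda>(i, j, k, l). (i, j, l, k)"]) (auto simp: swap_right)
  have "S (\<lambda>i j k l. K i j k l * (g i + g j - g k - g l)) =
      S (\<lambda>i j k l. K i j k l * g i) + S (\<lambda>i j k l. K i j k l * g j)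
      - S (\<lambda>i j k l. K i j k l * g k) - S (\<lambda>i j k l. K i j k l * g l)"
    unfolding S_def
    by (simp add: case_prod_beta distrib_left right_diff_distrib sum.distrib sum_subtractf)
  also have "\<dots> = 4 * S (\<lambda>i j k l. K i j k l * g i)"
    unfolding j l k by (simp add: S_def case_prod_beta sum_negf)
  finally show ?thesis
    by (simp add: nested sum_distrib_right)
qed

definition collision_kernel ::
  "real \<Rightarrow> (real \<Rightarrow> real) \<Rightarrow> (nat \<Rightarrow> real) \<Rightarrow> (nat \<Rightarrow> real) \<Rightarrow> nat \<Rightarrow> nat \<Rightarrow> nat \<Rightarrow> nat \<Rightarrow> real" where
  "collision_kernel w \<rho> \<epsilon> f i j k l =
     w ^ 3 * discrete_delta w i j k l * \<rho> (Min {\<epsilon> i, \<epsilon> j, \<epsilon> k, \<epsilon> l}) *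
     (f k * f l * (1 + f i) * (1 + f j) - f i * f j * (1 + f k) * (1 + f l))"

lemma discrete_collision_eq_sum_kernel:
  "discrete_collision R N \<rho> \<epsilon> f i =
     (\<Sum>j=1..N. \<Sum>k=1..N. \<Sum>l=1..N. collision_kernel (R / real N) \<rho> \<epsilon> f i j k l)"
  by (simp add: discrete_collision_def collision_kernel_def Let_def)

lemma collision_kernel_swap_left:
  "collision_kernel w \<rho> \<epsilon> f j i k l = collision_kernel w \<rho> \<epsilon> f i j k l"
proof -
  have "{\<epsilon> j, \<epsilon> i, \<epsilon> k, \<epsilon> l} = {\<epsilon> i, \<epsilon> j, \<epsilon> k, \<epsilon> l}"
    by auto
  moreover have "discrete_delta w j i k l = discrete_delta w i j k l"
    by (auto simp: discrete_delta_def)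
  ultimately show ?thesis
    by (simp add: collision_kernel_def algebra_simps)
qed

lemma collision_kernel_exchange:
  "collision_kernel w \<rho> \<epsilon> f k l i j = - collision_kernel w \<rho> \<epsilon> f i j k l"
proof -
  have "{\<epsilon> k, \<epsilon> l, \<epsilon> i, \<epsilon> j} = {\<epsilon> i, \<epsilon> j, \<epsilon> k, \<epsilon> l}"
    by auto
  moreover have "discrete_delta w k l i j = discrete_delta w i j k l"
    by (auto simp: discrete_delta_def)
  ultimately show ?thesis
    by (simp add: collision_kernel_def algebra_simps)
qed

lemma collision_kernel_swap_right:
  "collision_kernel w \<rho> \<epsilon> f i j l k = collision_kernel w \<rho> \<epsilon> f i j k l"
  using collision_kernel_swap_left[of w \<rho> \<epsilon> f l k i j]
  by (simp add: collision_kernel_exchange[of _ _ _ _ _ _ i j])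

lemma sum_collision_weak_form:
  "4 * (\<Sum>i=1..N. discrete_collision R N \<rho> \<epsilon> f i * g i) =
     (\<Sum>i=1..N. \<Sum>j=1..N. \<Sum>k=1..N. \<Sum>l=1..N.
        collision_kernel (R / real N) \<rho> \<epsilon> f i j k l * (g i + g j - g k - g l))"
  unfolding discrete_collision_eq_sum_kernel
  by (rule sum_antisymmetric_kernel)
    (rule collision_kernel_swap_left collision_kernel_swap_right collision_kernel_exchange)+

section \<open>Conservation laws\<close>

lemma equally_spaced_affine:
  assumes "equally_spaced N \<epsilon>"
  obtains a d where "\<And>i. i \<in> {1..N} \<Longrightarrow> \<epsilon> i = a + d * real i"
proof -
  obtain d where d: "\<forall>i\<in>{1..<N}. \<epsilon> (Suc i) - \<epsilon> i = d"
    using assms by (auto simp: equally_spaced_def)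
  have "i \<in> {1..N} \<longrightarrow> \<epsilon> i = (\<epsilon> 1 - d) + d * real i" for i
  proof (induction i)
    case (Suc i)
    show ?case
    proof (cases "i = 0")
      case False
      show ?thesis
      proof
        assume "Suc i \<in> {1..N}"
        with False have "i \<in> {1..<N}" by auto
        with Suc.IH d show "\<epsilon> (Suc i) = (\<epsilon> 1 - d) + d * real (Suc i)"
          by (force simp: algebra_simps)
      qed
    qed simp
  qed simp
  then show thesis
    using that by blast
qed

lemma sum_collision_affine_eq_0:
  assumes "\<And>i. i \<in> {1..N} \<Longrightarrow> g i = a + d * real i"
  shows "(\<Sum>i=1..N. discrete_collision R N \<rho> \<epsilon> f i * g i) = 0"
proof -
  have "collision_kernel (R / real N) \<rho> \<epsilon> f i j k l * (g i + g j - g k - g l) = 0"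
    if "i \<in> {1..N}" "j \<in> {1..N}" "k \<in> {1..N}" "l \<in> {1..N}" for i j k l
  proof (cases "i + j = k + l")
    case True
    then have "real i + real j = real k + real l"
      by linarith
    then have "d * real i + d * real j = d * real k + d * real l"
      by (simp flip: distrib_left)
    then show ?thesis
      using that assms by simp
  qed (simp add: collision_kernel_def discrete_delta_def)
  then have "4 * (\<Sum>i=1..N. discrete_collision R N \<rho> \<epsilon> f i * g i) = 0"
    unfolding sum_collision_weak_form by (intro sum.neutral ballI) simp
  then show ?thesis
    by simp
qed

section \<open>Entropy production\<close>

lemma collision_weight_nonneg:
  assumes "w \<ge> 0" and "\<forall>i\<in>{1..N}. \<epsilon> i \<in> {0..R}" and "\<forall>x\<in>{0..R}. \<rho> x \<ge> 0"
    and "i \<in> {1..N}" "j \<in> {1..N}" "k \<in> {1..N}" "l \<in> {1..N}"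
  shows "0 \<le> w ^ 3 * discrete_delta w i j k l * \<rho> (Min {\<epsilon> i, \<epsilon> j, \<epsilon> k, \<epsilon> l})"
proof -
  have "Min {\<epsilon> i, \<epsilon> j, \<epsilon> k, \<epsilon> l} \<in> {\<epsilon> i, \<epsilon> j, \<epsilon> k, \<epsilon> l}"
    by (rule Min_in) auto
  also have "\<dots> \<subseteq> {0..R}"
    using assms(2,4-7) by auto
  finally have "Min {\<epsilon> i, \<epsilon> j, \<epsilon> k, \<epsilon> l} \<in> {0..R}" .
  then show ?thesis
    using assms(1,3) by (simp add: discrete_delta_def)
qed

text \<open>
  If level \<open>i\<close> is empty, the loss terms of \<open>Q\<^sub>i\<close> vanish and the gain terms are nonnegative. Thus
  \<open>Q\<^sub>i = 0\<close> forces each of them to be zero.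
\<close>

lemma collision_kernel_empty_level:
  assumes R: "R \<ge> 0" and eps: "\<forall>i\<in>{1..N}. \<epsilon> i \<in> {0..R}" and rho: "\<forall>x\<in>{0..R}. \<rho> x \<ge> 0"
    and f: "\<And>i. i \<in> {1..N} \<Longrightarrow> 0 \<le> f i"
    and Q: "discrete_collision R N \<rho> \<epsilon> f i = 0" and empty: "f i = 0"
    and i: "i \<in> {1..N}" and jkl: "j \<in> {1..N}" "k \<in> {1..N}" "l \<in> {1..N}"
  shows "collision_kernel (R / real N) \<rho> \<epsilon> f i j k l = 0"
proof -
  let ?K = "collision_kernel (R / real N) \<rho> \<epsilon> f i"
  have nonneg: "0 \<le> ?K j k l" if "j \<in> {1..N}" "k \<in> {1..N}" "l \<in> {1..N}" for j k l
  proof -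
    have "0 \<le> f k * f l * (1 + f j)"
      using f that by (simp add: add_nonneg_nonneg)
    then show ?thesis
      unfolding collision_kernel_def using R empty
      by (intro mult_nonneg_nonneg[OF collision_weight_nonneg[OF _ eps rho i that]]) simp_all
  qed
  have "(\<Sum>j=1..N. \<Sum>k=1..N. \<Sum>l=1..N. ?K j k l) = 0"
    using Q by (simp add: discrete_collision_eq_sum_kernel)
  then have "(\<Sum>k=1..N. \<Sum>l=1..N. ?K j k l) = 0"
    using jkl by (subst (asm) sum_nonneg_eq_0_iff) (auto intro!: sum_nonneg nonneg)
  then have "(\<Sum>l=1..N. ?K j k l) = 0"
    using jkl by (subst (asm) sum_nonneg_eq_0_iff) (auto intro!: sum_nonneg nonneg)
  then show ?thesis
    using jkl by (subst (asm) sum_nonneg_eq_0_iff) (auto intro!: nonneg)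
qed

lemma diff_mult_ln_diff_nonneg:
  fixes x y :: real
  assumes "x > 0" and "y > 0"
  shows "0 \<le> (x - y) * (ln x - ln y)"
  using assms by (cases "x \<le> y") (auto intro: mult_nonneg_nonneg mult_nonpos_nonpos)

text \<open>
  The hypothesis that \<open>Q\<^sub>i\<close> vanishes at empty levels removes the quadruples on which
  \<open>h'(f\<^sub>i) = ln (1 + f\<^sub>i) - ln f\<^sub>i\<close> would be infinite. On
  all others, expanding the logarithms turns the symmetrised factor into \<open>ln X - ln Y\<close>.
\<close>

lemma sum_collision_entropy_nonneg:
  assumes R: "R \<ge> 0" and eps: "\<forall>i\<in>{1..N}. \<epsilon> i \<in> {0..R}" and rho: "\<forall>x\<in>{0..R}. \<rho> x \<ge> 0"
    and f: "\<And>i. i \<in> {1..N} \<Longrightarrow> 0 \<le> f i"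
    and Q: "\<And>i. i \<in> {1..N} \<Longrightarrow> f i = 0 \<Longrightarrow> discrete_collision R N \<rho> \<epsilon> f i = 0"
  shows "0 \<le> (\<Sum>i=1..N. discrete_collision R N \<rho> \<epsilon> f i * (ln (1 + f i) - ln (f i)))"
proof -
  define g where "g i = ln (1 + f i) - ln (f i)" for i
  let ?K = "collision_kernel (R / real N) \<rho> \<epsilon> f"
  have empty: "?K i j k l = 0"
    if "f i = 0" "i \<in> {1..N}" "j \<in> {1..N}" "k \<in> {1..N}" "l \<in> {1..N}" for i j k l
    using that by (intro collision_kernel_empty_level[OF R eps rho f Q]) auto
  have "0 \<le> ?K i j k l * (g i + g j - g k - g l)"
    if I: "i \<in> {1..N}" "j \<in> {1..N}" "k \<in> {1..N}" "l \<in> {1..N}" for i j k l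
  proof (cases "f i = 0 \<or> f j = 0 \<or> f k = 0 \<or> f l = 0")
    case True
    \<comment> \<open>By the symmetries of the kernel, the empty level may be taken as the first index.\<close>
    then have "?K i j k l = 0 \<or> ?K j i k l = 0 \<or> ?K k l i j = 0 \<or> ?K l k i j = 0"
      using I empty by blast
    then have "?K i j k l = 0"
      by (simp add: collision_kernel_swap_left[of _ _ _ _ j i] collision_kernel_swap_left[of _ _ _ _ l k]
          collision_kernel_exchange[of _ _ _ _ k l])
    then show ?thesis
      by simp
  next
    case False
    then have pos: "0 < f i" "0 < f j" "0 < f k" "0 < f l"
      using f[OF I(1)] f[OF I(2)] f[OF I(3)] f[OF I(4)] by linarith+
    let ?X = "f k * f l * (1 + f i) * (1 + f j)" and ?Y = "f i * f j * (1 + f k) * (1 + f l)"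
    have "0 \<le> (?X - ?Y) * (ln ?X - ln ?Y)"
      using pos by (intro diff_mult_ln_diff_nonneg) (auto intro!: mult_pos_pos add_pos_pos)
    also have "ln ?X - ln ?Y = g i + g j - g k - g l"
      using pos by (simp add: g_def ln_mult)
    finally have "0 \<le> (R / real N) ^ 3 * discrete_delta (R / real N) i j k l *
        \<rho> (Min {\<epsilon> i, \<epsilon> j, \<epsilon> k, \<epsilon> l}) * ((?X - ?Y) * (g i + g j - g k - g l))"
      using R by (intro mult_nonneg_nonneg[OF collision_weight_nonneg[OF _ eps rho I]]) simp
    then show ?thesis
      by (simp only: collision_kernel_def mult.assoc)
  qed
  then have "0 \<le> 4 * (\<Sum>i=1..N. discrete_collision R N \<rho> \<epsilon> f i * g i)"
    unfolding sum_collision_weak_form by (intro sum_nonneg)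
  then show ?thesis
    by (simp add: g_def)
qed

section \<open>Time derivatives\<close>

lemma entropy_density_nonneg:
  assumes "0 \<le> y"
  shows "0 \<le> entropy_density y"
proof (cases "y = 0")
  case False
  then have "y * ln y \<le> y * ln (1 + y)"
    using assms by simp
  also have "\<dots> \<le> (1 + y) * ln (1 + y)"
    using assms by (intro mult_right_mono) auto
  finally show ?thesis
    by (simp add: entropy_density_def)
qed (simp add: entropy_density_def)

lemma entropy_density_0: "entropy_density 0 = 0"
  by (simp add: entropy_density_def)

lemma DERIV_entropy_density:
  assumes "0 < y"
  shows "(entropy_density has_real_derivative (ln (1 + y) - ln y)) (at y)"
  unfolding entropy_density_def [abs_def] using assms
  by (auto intro!: derivative_eq_intros simp: field_simps)

lemma deriv_eq_0_at_local_min: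
  fixes u :: "real \<Rightarrow> real"
  assumes "u differentiable (at t)" and "\<forall>\<^sub>F s in nhds t. u t \<le> u s"
  shows "deriv u t = 0"
proof -
  have "(u has_real_derivative deriv u t) (at t)"
    using assms(1) by (simp add: DERIV_deriv_iff_real_differentiable)
  moreover obtain d where "0 < d" "\<And>s. dist s t < d \<Longrightarrow> u t \<le> u s"
    using assms(2) by (auto simp: eventually_nhds_metric)
  ultimately show ?thesis
    by (auto intro: DERIV_local_min simp: dist_real_def abs_minus_commute)
qed

lemma eventually_nhds_time_interval:
  assumes "0 < t" and "ereal t < T"
  shows "\<forall>\<^sub>F s in nhds t. 0 < s \<and> ereal s < T"
proof -
  have "\<forall>\<^sub>F s in nhds t. ereal s < T"
    using assms(2) by (intro order_tendstoD(2)[OF tendsto_ereal[OF filterlim_ident]])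
  moreover have "\<forall>\<^sub>F s in nhds t. 0 < s"
    using assms(1) by (intro order_tendstoD(1)[OF filterlim_ident])
  ultimately show ?thesis
    by eventually_elim simp
qed

section \<open>Conservation and entropy along solutions\<close>

theorem proposition2p1:
  fixes R :: real and N :: nat and \<epsilon> :: "nat \<Rightarrow> real" and \<rho> f\<^sub>0 :: "real \<Rightarrow> real"
    and T :: ereal and f :: "nat \<Rightarrow> real \<Rightarrow> real" and w :: real
  assumes "R > 0" and "N \<ge> 1" and "w = R / real N"
    and "\<forall>i\<in>{1..N}. \<epsilon> i \<in> {0..R}"
    and "mono_on {1..N} \<epsilon>"
    and "equally_spaced N \<epsilon>"
    and "\<forall>x\<in>{0..R}. \<rho> x \<ge> 0"
    and "\<forall>x\<in>{0..R}. f\<^sub>0 x \<ge> 0"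
    and "T > 0"
    and "discrete_solution R N \<rho> \<epsilon> f\<^sub>0 T f"
  shows "\<forall>t. 0 < t \<and> ereal t < T \<longrightarrow>
    (\<forall>\<phi>\<in>{\<lambda>x. 1, \<lambda>x. x}. w * (\<Sum>i=1..N. \<rho> (\<epsilon> i) * deriv (f i) t * \<phi> (\<epsilon> i)) = 0) \<and>
    ((\<forall>i\<in>{1..N}. \<rho> (\<epsilon> i) > 0 \<longrightarrow> (\<lambda>s. entropy_density (f i s)) differentiable (at t)) \<longrightarrow>
      w * (\<Sum>i=1..N. \<rho> (\<epsilon> i) * deriv (\<lambda>s. entropy_density (f i s)) t) \<ge> 0)"
proof (intro allI impI conjI ballI)
  fix t assume "0 < t \<and> ereal t < T"
  then have t: "0 < t" "ereal t < T"
    by auto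
  let ?Q = "discrete_collision R N \<rho> \<epsilon> (\<lambda>j. f j t)"
  have ode: "\<rho> (\<epsilon> i) * deriv (f i) t = ?Q i" and diff: "f i differentiable (at t)"
    if "i \<in> {1..N}" for i
    using assms(10) that t by (auto simp: discrete_solution_def)
  have nonneg: "0 \<le> f i s" if "i \<in> {1..N}" "0 < s" "ereal s < T" for i s
    using assms(10) that by (auto simp: discrete_solution_def)
  have near: "\<forall>\<^sub>F s in nhds t. 0 \<le> f i s" if "i \<in> {1..N}" for i
    using eventually_nhds_time_interval[OF t] by (rule eventually_mono) (use nonneg[OF that] in auto)
  have w: "0 < w"
    using assms(1-3) by simp
  {
    fix \<phi> :: "real \<Rightarrow> real"
    assume \<phi>: "\<phi> \<in> {\<lambda>x. 1, \<lambda>x. x}"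
    obtain a d where affine: "\<And>i. i \<in> {1..N} \<Longrightarrow> \<phi> (\<epsilon> i) = a + d * real i"
    proof (cases "\<phi> = (\<lambda>x. 1)")
      case True
      then show thesis
        using that[of 1 0] by simp
    next
      case False
      then have "\<phi> = (\<lambda>x. x)"
        using \<phi> by blast
      then show thesis
        using equally_spaced_affine[OF assms(6)] that by metis
    qed
    have "(\<Sum>i=1..N. ?Q i * \<phi> (\<epsilon> i)) = 0"
      by (rule sum_collision_affine_eq_0[OF affine])
    then show "w * (\<Sum>i=1..N. \<rho> (\<epsilon> i) * deriv (f i) t * \<phi> (\<epsilon> i)) = 0"
      by (simp add: ode)
  }
  assume h_diff: "\<forall>i\<in>{1..N}. \<rho> (\<epsilon> i) > 0 \<longrightarrow>
    (\<lambda>s. entropy_density (f i s)) differentiable (at t)"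
  have empty: "?Q i = 0" if i: "i \<in> {1..N}" and "f i t = 0" for i
  proof -
    have "deriv (f i) t = 0"
      using near[OF i] \<open>f i t = 0\<close> by (intro deriv_eq_0_at_local_min[OF diff[OF i]]) simp
    then show ?thesis
      using ode[OF i] by simp
  qed
  have chain: "\<rho> (\<epsilon> i) * deriv (\<lambda>s. entropy_density (f i s)) t =
      ?Q i * (ln (1 + f i t) - ln (f i t))" if i: "i \<in> {1..N}" for i
  proof -
    have "0 \<le> \<rho> (\<epsilon> i)" and "0 \<le> f i t"
      using assms(4,7) i nonneg[OF i t] by blast+
    then consider "\<rho> (\<epsilon> i) = 0" | "0 < \<rho> (\<epsilon> i)" "f i t = 0" | "0 < f i t"
      unfolding order_le_less by metis
    then show ?thesis
    proof cases
      \<comment> \<open>Levels of zero weight: the equation itself says that \<open>Q\<^sub>i = 0\<close>.\<close>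
      case 1
      then show ?thesis
        using ode[OF i] by simp
    next
      \<comment> \<open>Vacuum: both \<open>Q\<^sub>i\<close> and the entropy derivative vanish, because \<open>f\<^sub>i\<close> and \<open>h(f\<^sub>i)\<close> are minimal.\<close>
      case 2
      then have "\<forall>\<^sub>F s in nhds t. entropy_density (f i t) \<le> entropy_density (f i s)"
        using near[OF i] by (auto simp: entropy_density_0 elim!: eventually_mono intro: entropy_density_nonneg)
      then have "deriv (\<lambda>s. entropy_density (f i s)) t = 0"
        using h_diff i 2 by (intro deriv_eq_0_at_local_min) auto
      then show ?thesis
        using empty[OF i] 2 by simp
    next
      case 3
      have "(f i has_real_derivative deriv (f i) t) (at t)"
        using diff[OF i] by (simp add: DERIV_deriv_iff_real_differentiable)
      then have "((\<lambda>s. entropy_density (f i s)) has_real_derivative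
          (ln (1 + f i t) - ln (f i t)) * deriv (f i) t) (at t)"
        by (rule DERIV_chain2[where g = "f i", OF DERIV_entropy_density[OF 3]])
      then have "deriv (\<lambda>s. entropy_density (f i s)) t = (ln (1 + f i t) - ln (f i t)) * deriv (f i) t"
        by (rule DERIV_imp_deriv)
      then show ?thesis
        by (simp add: mult_ac flip: ode[OF i])
    qed
  qed
  have "0 \<le> (\<Sum>i=1..N. ?Q i * (ln (1 + f i t) - ln (f i t)))"
    using assms(1) nonneg t empty
    by (intro sum_collision_entropy_nonneg[OF _ assms(4,7)]) auto
  then show "0 \<le> w * (\<Sum>i=1..N. \<rho> (\<epsilon> i) * deriv (\<lambda>s. entropy_density (f i s)) t)"
    using w by (simp add: chain)
qed

end
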